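(* Let $M=\mathbb S^1$, let $L=\frac12\frac{\partial^2}{\partial x^2}$, and let $V:M\to\mathbb R$ be a Lipschitz function. Let $\mu$ be a finite Borel measure on $M$ such that $L$ is selfadjoint in $L^2(\mu)$ in the sense that $$\int_M (Lf)(x)\,g(x)\,d\mu(x)=\int_M f(x)\,(Lg)(x)\,d\mu(x)\qquad\text{for all } f,g\in C^2(M).$$ Let $\mathbb P_\mu$ be the measure on path space $\mathcal C$ induced by the initial measure $\mu$ and the infinitesimal generator $L$. Then, for every $t\ge0$ and all continuous functions $f,g:M\to\mathbb R$, $$\int_{\mathcal C}e^{\int_0^tV(w(r))\,dr}f(w(t))\,g(w(0))\,d\mathbb P_\mu(w)=\int_{\mathcal C}e^{\int_0^tV(w(r))\,dr}f(w(0))\,g(w(t))\,d\mathbb P_\mu(w).$$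
   Context: $M=\mathbb S^1$ is the interval $[0,1]$ with $0\equiv1$, with the Euclidean metric. $\mathcal C$ is the space of continuous paths $w:[0,\infty)\to M$. $\mathbb P_x$ is the law on $\mathcal C$ of Brownian motion on $M$ started at $x$, i.e. of the diffusion with infinitesimal generator $L=\frac12\frac{\partial^2}{\partial x^2}$ on $C^2(M)$. For a measure $\mu$ on $M$, $\mathbb P_\mu[A]=\int_M\mathbb P_x[A]\,d\mu(x)$ for measurable $A\subset\mathcal C$. *)

theory Defs
  imports "HOL-Probability.Probability"
begin

section \<open>The circle\<close>

quotient_type circle = real / "\<lambda>x y::real. x - y \<in> \<int>"
  morphisms rep_circle circle_of
proof (rule equivpI)
  show "reflp (\<lambda>x y::real. x - y \<in> \<int>)"
    by (simp add: reflp_def)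
  show "symp (\<lambda>x y::real. x - y \<in> \<int>)"
    by (rule sympI) (metis Ints_minus minus_diff_eq)
  show "transp (\<lambda>x y::real. x - y \<in> \<int>)"
  proof (rule transpI)
    fix x y z :: real
    assume "x - y \<in> \<int>" "y - z \<in> \<int>"
    then have "(x - y) + (y - z) \<in> \<int>" by (rule Ints_add)
    then show "x - z \<in> \<int>" by simp
  qed
qed

lemma infdist_Ints_shift:
  fixes a b :: real
  assumes "a - b \<in> \<int>"
  shows "infdist a \<int> = infdist b \<int>"
proof -
  have le: "infdist a \<int> \<le> infdist b \<int>" if "a - b \<in> \<int>" for a b :: real
  proof -
    have "infdist a \<int> \<le> dist b m" if "m \<in> \<int>" for m :: real
    proof -
      have "m + (a - b) \<in> \<int>" using \<open>a - b \<in> \<int>\<close> that by (rule Ints_add[rotated])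
      then have "infdist a \<int> \<le> dist a (m + (a - b))" by (rule infdist_le)
      also have "\<dots> = dist b m" by (simp add: dist_real_def)
      finally show ?thesis .
    qed
    then have "infdist a \<int> \<le> (INF m\<in>\<int>. dist b m)"
      by (intro cINF_greatest) auto
    then show ?thesis by (simp add: infdist_def split: if_splits)
  qed
  have "b - a \<in> \<int>" using Ints_minus[OF assms] by simp
  then show ?thesis using le[OF assms] le[of b a] by simp
qed

lemma infdist_Ints_minus: "infdist (- a) \<int> = infdist (a::real) \<int>"
proof -
  have le: "infdist (- a) \<int> \<le> infdist a \<int>" for a :: real
  proof -
    have "infdist (- a) \<int> \<le> dist a m" if "m \<in> \<int>" for m :: real
    proof -
      have "infdist (- a) \<int> \<le> dist (- a) (- m)" using that by (intro infdist_le Ints_minus)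
      also have "\<dots> = dist a m" by (simp add: dist_real_def)
      finally show ?thesis .
    qed
    then have "infdist (- a) \<int> \<le> (INF m\<in>\<int>. dist a m)"
      by (intro cINF_greatest) auto
    then show ?thesis by (simp add: infdist_def split: if_splits)
  qed
  show ?thesis using le[of a] le[of "- a"] by simp
qed

lemma infdist_Ints_add: "infdist (a + b) \<int> \<le> infdist a \<int> + infdist (b::real) \<int>"
proof -
  have "infdist (a + b) \<int> - infdist a \<int> \<le> dist b m" if "m \<in> \<int>" for m :: real
  proof -
    have "infdist (a + b) \<int> \<le> infdist (a + m) \<int> + dist (a + b) (a + m)"
      by (rule infdist_triangle)
    moreover have "infdist (a + m) \<int> = infdist a \<int>"
      by (rule infdist_Ints_shift) (use that in simp)
    ultimately show ?thesis by (simp add: dist_real_def)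
  qed
  then have "infdist (a + b) \<int> - infdist a \<int> \<le> (INF m\<in>\<int>. dist b m)"
    by (intro cINF_greatest) auto
  then show ?thesis by (simp add: infdist_def split: if_splits)
qed

text \<open>The distance of two points is the minimum of the Euclidean distances of their representatives.\<close>

instantiation circle :: metric_space
begin

lift_definition dist_circle :: "circle \<Rightarrow> circle \<Rightarrow> real"
  is "\<lambda>x y. infdist (x - y) \<int>"
proof -
  fix x x' y y' :: real
  assume "x - x' \<in> \<int>" "y - y' \<in> \<int>"
  then have "(x - x') - (y - y') \<in> \<int>" by (rule Ints_diff)
  then show "infdist (x - y) \<int> = infdist (x' - y') \<int>"
    by (intro infdist_Ints_shift) (simp add: algebra_simps)
qed

definition uniformity_circle :: "(circle \<times> circle) filter"
  where "uniformity_circle = (INF e\<in>{0 <..}. principal {(x, y). dist x y < e})"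

definition open_circle :: "circle set \<Rightarrow> bool"
  where "open_circle U \<longleftrightarrow> (\<forall>x\<in>U. eventually (\<lambda>(x', y). x' = x \<longrightarrow> y \<in> U) uniformity)"

instance
proof
  fix x y z :: circle
  show "dist x y = 0 \<longleftrightarrow> x = y"
    by transfer (use in_closed_iff_infdist_zero[of "\<int> :: real set"] in \<open>auto simp: closed_Ints\<close>)
  show "dist x y \<le> dist x z + dist y z"
  proof transfer
    fix x y z :: real
    show "infdist (x - y) \<int> \<le> infdist (x - z) \<int> + infdist (y - z) \<int>"
      using infdist_Ints_add[of "x - z" "z - y"] infdist_Ints_minus[of "y - z"] by simp
  qed
qed (simp_all add: uniformity_circle_def open_circle_def)

end

lemma dist_circle_of_le: "dist (circle_of x) (circle_of y) \<le> \<bar>x - y\<bar>"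
proof -
  have "infdist (x - y) \<int> \<le> dist (x - y) 0" by (rule infdist_le) simp
  then show ?thesis by (simp add: dist_circle.abs_eq)
qed

lemma continuous_on_circle_of: "continuous_on S circle_of"
  unfolding continuous_on_iff
  by (metis dist_circle_of_le dist_real_def le_less_trans)

section \<open>The generator\<close>

lemma deriv_periodic:
  fixes f :: "real \<Rightarrow> real"
  assumes f: "\<And>x y. x - y \<in> \<int> \<Longrightarrow> f x = f y" and xy: "x - y \<in> \<int>"
  shows "deriv f x = deriv f y"
proof -
  have "f \<circ> (\<lambda>h. x + h) = f \<circ> (\<lambda>h. y + h)"
  proof
    fix h
    have "f (x + h) = f (y + h)" by (rule f) (use xy in simp)
    then show "(f \<circ> (\<lambda>h. x + h)) h = (f \<circ> (\<lambda>h. y + h)) h" by simp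
  qed
  then show ?thesis
    by (metis deriv_shift_0)
qed

text \<open>A function on the circle is differentiated as a 1-periodic function on the line.\<close>

lift_definition circle_deriv :: "(circle \<Rightarrow> real) \<Rightarrow> circle \<Rightarrow> real"
  is "deriv :: (real \<Rightarrow> real) \<Rightarrow> real \<Rightarrow> real"
proof -
  fix f g :: "real \<Rightarrow> real" and x y :: real
  assume fg: "\<And>x y. x - y \<in> \<int> \<Longrightarrow> f x = g y" and xy: "x - y \<in> \<int>"
  have "f = g" using fg by (intro ext) simp
  then show "deriv f x = deriv g y"
    using deriv_periodic[of g x y] fg xy by simp
qed

lemma circle_deriv_circle_of:
  "circle_deriv f (circle_of x) = deriv (\<lambda>s. f (circle_of s)) x"
proof -
  have "circle_of (rep_circle (circle_of x)) = circle_of x"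
    by (rule Quotient3_abs_rep[OF Quotient3_circle])
  then have rep: "rep_circle (circle_of x) - x \<in> \<int>"
    by (simp add: circle.abs_eq_iff)
  have "circle_deriv f (circle_of x) = deriv (\<lambda>s. f (circle_of s)) (rep_circle (circle_of x))"
    by (simp add: circle_deriv_def map_fun_def comp_def)
  also have "\<dots> = deriv (\<lambda>s. f (circle_of s)) x"
  proof (rule deriv_periodic[OF _ rep])
    fix u v :: real
    assume "u - v \<in> \<int>"
    then have "circle_of u = circle_of v" by (simp add: circle.abs_eq_iff)
    then show "f (circle_of u) = f (circle_of v)" by simp
  qed
  finally show ?thesis .
qed

definition C2_circle :: "(circle \<Rightarrow> real) set" where
  "C2_circle = {f.
     (\<forall>x. (\<lambda>s. f (circle_of s)) differentiable at x) \<and>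
     (\<forall>x. (\<lambda>s. circle_deriv f (circle_of s)) differentiable at x) \<and>
     continuous_on UNIV (circle_deriv (circle_deriv f))}"

definition half_laplacian :: "(circle \<Rightarrow> real) \<Rightarrow> circle \<Rightarrow> real" where
  "half_laplacian f x = 1/2 * circle_deriv (circle_deriv f) x"

definition selfadjoint_in_L2 ::
    "('a \<Rightarrow> real) set \<Rightarrow> (('a \<Rightarrow> real) \<Rightarrow> 'a \<Rightarrow> real) \<Rightarrow> 'a measure \<Rightarrow> bool" where
  "selfadjoint_in_L2 D L \<mu> \<longleftrightarrow>
     (\<forall>f\<in>D. \<forall>g\<in>D. (\<integral>x. L f x * g x \<partial>\<mu>) = (\<integral>x. f x * L g x \<partial>\<mu>))"

section \<open>Path space and diffusions\<close>

text \<open>A path is a function on the time set \<open>{0..}\<close> (extensional on the reals, as usual for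
  \<^const>\<open>PiM\<close>). The sigma-algebra is the one generated by the coordinate maps, which is also the
  Borel sigma-algebra of locally uniform convergence.\<close>

definition path_space :: "(real \<Rightarrow> circle) measure" where
  "path_space = restrict_space (\<Pi>\<^sub>M t\<in>{0..}. borel) {w. continuous_on {0..} w}"

definition path_filtration :: "real \<Rightarrow> (real \<Rightarrow> circle) measure" where
  "path_filtration s =
     vimage_algebra (space path_space) (\<lambda>w. restrict w {0..s}) (\<Pi>\<^sub>M t\<in>{0..s}. borel)"

definition transition_op ::
    "(circle \<Rightarrow> (real \<Rightarrow> circle) measure) \<Rightarrow> real \<Rightarrow> (circle \<Rightarrow> real) \<Rightarrow> circle \<Rightarrow> real" where
  "transition_op P t f x = (\<integral>w. f (w t) \<partial>P x)"

text \<open>\<open>P x\<close> is the law of the diffusion started at \<open>x\<close>: a Markov family of laws on continuous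
  paths such that \<open>L\<close> is its infinitesimal generator on \<open>D\<close>, with respect to the
  supremum norm as usual.\<close>

definition diffusion_with_generator ::
    "(circle \<Rightarrow> real) set \<Rightarrow> ((circle \<Rightarrow> real) \<Rightarrow> circle \<Rightarrow> real) \<Rightarrow>
     (circle \<Rightarrow> (real \<Rightarrow> circle) measure) \<Rightarrow> bool" where
  "diffusion_with_generator D L P \<longleftrightarrow>
     P \<in> borel \<rightarrow>\<^sub>M prob_algebra path_space \<and>
     (\<forall>x. AE w in P x. w 0 = x) \<and>
     (\<forall>x. \<forall>s\<ge>0. \<forall>t\<ge>0. \<forall>f\<in>borel_measurable borel. bounded (range f) \<longrightarrow>
        (AE w in P x.
           real_cond_exp (P x) (path_filtration s) (\<lambda>w. f (w (s + t))) w
             = transition_op P t f (w s))) \<and>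
     (\<forall>f\<in>D. uniform_limit UNIV (\<lambda>t x. (transition_op P t f x - f x) / t) (L f) (at_right 0))"

definition initial_law ::
    "(circle \<Rightarrow> (real \<Rightarrow> circle) measure) \<Rightarrow> circle measure \<Rightarrow> (real \<Rightarrow> circle) measure" where
  "initial_law P \<mu> = bind \<mu> P"

text \<open>\<^const>\<open>bind\<close> is meant for subprobability measures, but it gives the intended
  mixture of the laws \<open>P x\<close> for every Borel measure \<open>\<mu>\<close>.\<close>

lemma emeasure_initial_law:
  assumes "diffusion_with_generator D L P" "sets \<mu> = sets borel" "A \<in> sets path_space"
  shows "emeasure (initial_law P \<mu>) A = (\<integral>\<^sup>+x. emeasure (P x) A \<partial>\<mu>)"
proof -
  have "P \<in> borel \<rightarrow>\<^sub>M subprob_algebra path_space"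
    using assms(1) by (auto simp: diffusion_with_generator_def intro: measurable_prob_algebraD)
  then have "P \<in> \<mu> \<rightarrow>\<^sub>M subprob_algebra path_space"
    using measurable_cong_sets[OF assms(2) refl] by blast
  moreover have "space \<mu> \<noteq> {}"
    using sets_eq_imp_space_eq[OF assms(2)] by simp
  ultimately show ?thesis
    unfolding initial_law_def using assms(3) by (intro emeasure_bind)
qed

end

theory Submission
  imports Defs
begin

text \<open>The functions \<open>a cos (2 \<pi> k x + \<theta>)\<close> are eigenfunctions of the generator, so the
  transition operators damp them by \<open>exp (- 2 \<pi>\<^sup>2 k\<^sup>2 t)\<close>. Selfadjointness makes those of different
  frequency orthogonal in \<open>L\<^sup>2(\<mu>)\<close>, hence the transition operators are symmetric on trigonometric
  polynomials, and by Stone-Weierstrass on all continuous functions. Replacing the integral in the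
  exponent by a Riemann sum that contains both endpoints, with mesh \<open>h\<close>, the Markov property turns
  the expectation into a palindromic product of multiplications by \<open>exp (h V)\<close> and transition
  operators at time \<open>h\<close>, which is symmetric. Dominated convergence gives the theorem.\<close>

section \<open>Trigonometric polynomials on the circle\<close>

lemma circle_of_rep_circle: "circle_of (rep_circle x) = x"
  by (rule Quotient3_abs_rep[OF Quotient3_circle])

lemma circle_cases: obtains s where "x = circle_of s"
  by (metis circle_of_rep_circle)

lemma circle_of_eq_iff: "circle_of s = circle_of t \<longleftrightarrow> s - t \<in> \<int>"
  by (simp add: circle.abs_eq_iff)

text \<open>Every point is represented by some \<open>frac s\<close> in \<open>{0..1}\<close>, so
  the circle is a continuous image of a compact interval.\<close>

lemma compact_circle: "compact (UNIV :: circle set)"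
proof -
  have "circle_of s \<in> circle_of ` {0..1}" for s
  proof (rule image_eqI)
    show "circle_of s = circle_of (frac s)"
      by (simp add: circle_of_eq_iff frac_def)
    show "frac s \<in> {0..1}"
      by (auto intro: less_imp_le frac_lt_1)
  qed
  then have "UNIV = circle_of ` {0..1}"
    by (metis UNIV_eq_I circle_of_rep_circle)
  then show ?thesis
    by (metis compact_continuous_image compact_Icc continuous_on_circle_of)
qed

lemma bounded_range_continuous_circle:
  fixes f :: "circle \<Rightarrow> real"
  assumes "continuous_on UNIV f"
  shows "bounded (range f)"
  by (rule compact_imp_bounded) (rule compact_continuous_image[OF assms compact_circle])

text \<open>The circle carries a metric topology rather than a declared quotient topology, so
  lifting continuity takes an argument. On \<open>{0..1}\<close> the projection is a closed map: the
  preimage of a closed set is the projection of a compact set of representatives, hence compact and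
  closed.\<close>

lemma continuous_on_circleI:
  fixes f :: "circle \<Rightarrow> real"
  assumes "continuous_on UNIV (\<lambda>s. f (circle_of s))"
  shows "continuous_on UNIV f"
proof -
  have closed: "closed (f -` C)" if "closed C" for C
  proof -
    have "f -` C = circle_of ` ({0..1} \<inter> (\<lambda>s. f (circle_of s)) -` C)"
    proof (intro equalityI subsetI)
      fix x assume "x \<in> f -` C"
      moreover have "x = circle_of (frac (rep_circle x))"
        using circle_of_eq_iff[of "rep_circle x" "frac (rep_circle x)"]
        by (simp add: frac_def circle_of_rep_circle)
      ultimately show "x \<in> circle_of ` ({0..1} \<inter> (\<lambda>s. f (circle_of s)) -` C)"
        by (intro image_eqI[of _ _ "frac (rep_circle x)"])
           (auto intro: less_imp_le frac_lt_1)
    qed auto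
    moreover have "compact ({0..1} \<inter> (\<lambda>s. f (circle_of s)) -` C)"
      using closed_vimage[OF that assms]
      by (intro compact_Int_closed) (auto simp: closed_vimage)
    ultimately show ?thesis
      by (metis compact_continuous_image compact_imp_closed continuous_on_circle_of)
  qed
  show ?thesis
    using closed by (simp add: continuous_on_closed_vimage)
qed

section \<open>Waves and their algebra\<close>

lift_definition wave :: "real \<Rightarrow> int \<Rightarrow> real \<Rightarrow> circle \<Rightarrow> real"
  is "\<lambda>a k \<theta> s. a * cos (2 * pi * of_int k * s + \<theta>)"
proof -
  fix a \<theta> s t :: real and k :: int
  assume "s - t \<in> \<int>"
  then obtain n where "s = t + of_int n"
    by (metis Ints_cases add.commute diff_add_cancel)
  then have "2 * pi * of_int k * s + \<theta> = (2 * pi * of_int k * t + \<theta>) + 2 * pi * of_int (k * n)"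
    by (simp add: algebra_simps)
  then show "a * cos (2 * pi * of_int k * s + \<theta>) = a * cos (2 * pi * of_int k * t + \<theta>)"
    by (metis sin_cos_eq_iff)
qed

lemma wave_circle_of: "wave a k \<theta> (circle_of s) = a * cos (2 * pi * of_int k * s + \<theta>)"
  by (rule wave.abs_eq)

lemma has_field_derivative_wave:
  "((\<lambda>s. wave a k \<theta> (circle_of s)) has_field_derivative
     wave (2 * pi * of_int k * a) k (\<theta> + pi / 2) (circle_of s)) (at s)"
  unfolding wave_circle_of
  by (rule derivative_eq_intros refl | simp add: cos_add sin_add)+

lemma continuous_on_wave: "continuous_on UNIV (wave a k \<theta>)"
  by (rule continuous_on_circleI) (auto simp: wave_circle_of intro!: continuous_intros)

text \<open>Amplitude and phase are parameters of a wave precisely so that the family is closed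
  under differentiation: the derivative scales the amplitude and advances the phase by a quarter
  turn. Sines are included as phase shifts.\<close>

lemma circle_deriv_wave:
  "circle_deriv (wave a k \<theta>) = wave (2 * pi * of_int k * a) k (\<theta> + pi / 2)"
proof
  fix x
  obtain s where "x = circle_of s" by (rule circle_cases)
  then show "circle_deriv (wave a k \<theta>) x = wave (2 * pi * of_int k * a) k (\<theta> + pi / 2) x"
    using DERIV_imp_deriv[OF has_field_derivative_wave] by (simp add: circle_deriv_circle_of)
qed

lemma wave_in_C2_circle: "wave a k \<theta> \<in> C2_circle"
  unfolding C2_circle_def mem_Collect_eq circle_deriv_wave real_differentiable_def
  using has_field_derivative_wave continuous_on_wave by blast

text \<open>Two quarter turns of the phase reverse the sign, and half of
  \<open>(2 * pi * k)\<^sup>2\<close> is \<open>2 * (pi * k)\<^sup>2\<close>.\<close>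

lemma half_laplacian_wave:
  "half_laplacian (wave a k \<theta>) x = - (2 * (pi * of_int k)\<^sup>2) * wave a k \<theta> x"
proof -
  obtain s where "x = circle_of s" by (rule circle_cases)
  then show ?thesis
    by (simp add: half_laplacian_def circle_deriv_wave wave_circle_of cos_add sin_add
        power2_eq_square algebra_simps)
qed

text \<open>Scalars are absorbed in the amplitudes, so sums of waves already form the whole linear
  span. A linear or bilinear claim then reduces by induction to single waves.\<close>

inductive trigonometric :: "(circle \<Rightarrow> real) \<Rightarrow> bool" where
  wave: "trigonometric (wave a k \<theta>)"
| add: "trigonometric f \<Longrightarrow> trigonometric g \<Longrightarrow> trigonometric (\<lambda>x. f x + g x)"

lemma trigonometric_const: "trigonometric (\<lambda>_. c)"
proof -
  have "wave c 0 0 = (\<lambda>_. c)"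
    using wave_circle_of[of c 0 0] by (intro ext) (metis circle_cases add.right_neutral cos_zero
      mult.right_neutral mult_zero_left mult_zero_right of_int_0)
  then show ?thesis
    using trigonometric.wave by metis
qed

lemma continuous_on_trigonometric: "trigonometric f \<Longrightarrow> continuous_on UNIV f"
  by (induction rule: trigonometric.induct) (auto intro: continuous_on_wave continuous_on_add)

text \<open>This is the product-to-sum formula for cosines. It makes the span of the waves an
  algebra, as Stone-Weierstrass requires.\<close>

lemma wave_mult_wave:
  "wave a k \<theta> x * wave b l \<phi> x =
     wave (a * b / 2) (k - l) (\<theta> - \<phi>) x + wave (a * b / 2) (k + l) (\<theta> + \<phi>) x"
proof -
  obtain s where s: "x = circle_of s" by (rule circle_cases)
  let ?A = "2 * pi * of_int k * s + \<theta>" and ?B = "2 * pi * of_int l * s + \<phi>"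
  have "2 * pi * of_int (k - l) * s + (\<theta> - \<phi>) = ?A - ?B"
    "2 * pi * of_int (k + l) * s + (\<theta> + \<phi>) = ?A + ?B"
    by (simp_all add: algebra_simps)
  moreover have "a * cos ?A * (b * cos ?B) = a * b / 2 * cos (?A - ?B) + a * b / 2 * cos (?A + ?B)"
    using cos_times_cos[of ?A ?B] by (simp add: field_simps)
  ultimately show ?thesis
    unfolding s wave_circle_of by presburger
qed

lemma trigonometric_mult:
  assumes "trigonometric f" "trigonometric g"
  shows "trigonometric (\<lambda>x. f x * g x)"
  using assms
proof (induction f rule: trigonometric.induct)
  case (wave a k \<theta>)
  from wave show ?case
  proof (induction g rule: trigonometric.induct)
    case (wave b l \<phi>)
    then show ?case
      unfolding wave_mult_wave by (intro trigonometric.intros)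
  next
    case (add f g)
    then show ?case
      by (auto simp: distrib_left intro: trigonometric.add)
  qed
next
  case (add f h)
  then show ?case
    by (auto simp: distrib_right intro: trigonometric.add)
qed

lemma trigonometric_separates_points:
  assumes "x \<noteq> y"
  shows "\<exists>f. trigonometric f \<and> f x \<noteq> f y"
proof (rule ccontr)
  assume *: "\<not> ?thesis"
  obtain s t where st: "x = circle_of s" "y = circle_of t" by (metis circle_cases)
  \<comment> \<open>The phase \<open>- pi / 2\<close> turns the cosine into a sine; together the two
    values determine \<open>s\<close> modulo 1.\<close>
  from * have "wave 1 1 0 x = wave 1 1 0 y" "wave 1 1 (- pi / 2) x = wave 1 1 (- pi / 2) y"
    using trigonometric.wave by metis+
  then have "cos (2 * pi * s) = cos (2 * pi * t)" "sin (2 * pi * s) = sin (2 * pi * t)"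
    by (simp_all add: st wave_circle_of cos_diff)
  then obtain n :: int where "2 * pi * s = 2 * pi * t + 2 * pi * of_int n"
    using sin_cos_eq_iff by metis
  then have "s - t = of_int n"
    by (simp flip: distrib_left)
  then show False
    using assms by (simp add: st circle_of_eq_iff)
qed

lemma trigonometric_dense:
  assumes "continuous_on UNIV f"
  shows "\<exists>F. (\<forall>n. trigonometric (F n)) \<and> uniform_limit UNIV F f sequentially"
proof -
  interpret function_ring_on "Collect trigonometric" "UNIV :: circle set"
    by unfold_locales
      (auto simp: compact_circle continuous_on_trigonometric trigonometric_const
        trigonometric_separates_points intro: trigonometric.add trigonometric_mult)
  show ?thesis
    using Stone_Weierstrass[OF assms] by blast
qed

section \<open>Transition operators\<close>

text \<open>These are the test functions for which \<open>diffusion_with_generator\<close> supplies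
  the Markov property. The class contains the continuous functions on the circle and is stable under
  products and transition operators.\<close>

definition bounded_borel :: "('a::topological_space \<Rightarrow> real) set" where
  "bounded_borel = {f \<in> borel_measurable borel. bounded (range f)}"

lemma bounded_borelI:
  assumes "f \<in> borel_measurable borel" "\<And>x. \<bar>f x\<bar> \<le> C"
  shows "f \<in> bounded_borel"
  using assms by (auto simp: bounded_borel_def bounded_iff)

lemma bounded_borel_measurable: "f \<in> bounded_borel \<Longrightarrow> f \<in> borel_measurable borel"
  by (simp add: bounded_borel_def)

lemma bounded_borelE:
  assumes "f \<in> bounded_borel"
  obtains C where "\<And>x. \<bar>f x\<bar> \<le> C"
  using assms by (auto simp: bounded_borel_def bounded_iff)

lemma bounded_borel_mult:
  assumes "f \<in> bounded_borel" "g \<in> bounded_borel"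
  shows "(\<lambda>x. f x * g x) \<in> bounded_borel"
proof -
  obtain C where C: "\<And>x. \<bar>f x\<bar> \<le> C" using assms(1) by (rule bounded_borelE) blast
  obtain E where E: "\<And>x. \<bar>g x\<bar> \<le> E" using assms(2) by (rule bounded_borelE) blast
  show ?thesis
  proof (rule bounded_borelI)
    show "(\<lambda>x. f x * g x) \<in> borel_measurable borel"
      using assms by (auto simp: bounded_borel_def)
    show "\<bar>f x * g x\<bar> \<le> C * E" for x
      using mult_mono[OF C E] abs_ge_zero[of "f x"] C[of x] by (simp add: abs_mult)
  qed
qed

lemma bounded_borel_const: "(\<lambda>_. c) \<in> bounded_borel"
  by (rule bounded_borelI[of _ "\<bar>c\<bar>"]) auto

lemma bounded_borel_continuous_circle:
  fixes f :: "circle \<Rightarrow> real"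
  assumes "continuous_on UNIV f"
  shows "f \<in> bounded_borel"
  using assms
  by (simp add: bounded_borel_def borel_measurable_continuous_onI bounded_range_continuous_circle)

lemma integrable_bounded_borel:
  assumes "finite_measure M" "f \<in> bounded_borel" "sets M = sets borel"
  shows "integrable M f"
proof -
  obtain C where "\<And>x. \<bar>f x\<bar> \<le> C" using assms(2) by (rule bounded_borelE) blast
  moreover have "f \<in> borel_measurable M"
    using bounded_borel_measurable[OF assms(2)] measurable_cong_sets[OF assms(3) refl] by blast
  ultimately show ?thesis
    by (intro finite_measure.integrable_const_bound[OF assms(1), of _ C]) auto
qed

section \<open>Coordinate maps and the filtration of path space\<close>

lemma measurable_coordinate:
  assumes "0 \<le> t"
  shows "(\<lambda>w. w t) \<in> path_space \<rightarrow>\<^sub>M borel"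
  unfolding path_space_def
  using assms by (intro measurable_restrict_space1 measurable_component_singleton) simp

lemma continuous_on_path:
  "w \<in> space path_space \<Longrightarrow> continuous_on {0..} w"
  by (simp add: path_space_def space_restrict_space)

lemma measurable_coordinate_filtration:
  assumes "0 \<le> r" "r \<le> s"
  shows "(\<lambda>w. w r) \<in> path_filtration s \<rightarrow>\<^sub>M borel"
proof -
  have "(\<lambda>w. restrict w {0..s}) \<in> path_filtration s \<rightarrow>\<^sub>M (\<Pi>\<^sub>M t\<in>{0..s}. borel)"
    unfolding path_filtration_def
    by (rule measurable_vimage_algebra1) (auto simp: space_PiM)
  then have "(\<lambda>w. restrict w {0..s} r) \<in> path_filtration s \<rightarrow>\<^sub>M borel"
    by (rule measurable_compose) (rule measurable_component_singleton, use assms in simp)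
  then show ?thesis
    using assms by simp
qed

text \<open>Restriction to \<open>{0..s}\<close> is measurable on path space, so the sigma-algebra
  that it generates is contained in the full one. This makes conditional expectations given the past
  available.\<close>

lemma subalgebra_path_filtration:
  assumes "sets M = sets path_space"
  shows "subalgebra M (path_filtration s)"
proof -
  have "(\<lambda>w. restrict w {0..s}) \<in> path_space \<rightarrow>\<^sub>M (\<Pi>\<^sub>M t\<in>{0..s}. borel)"
    by (rule measurable_restrict) (simp add: measurable_coordinate)
  then have "sets (path_filtration s) \<subseteq> sets path_space"
    unfolding path_filtration_def by (intro sets_image_in_sets) auto
  then show ?thesis
    using assms sets_eq_imp_space_eq[OF assms]
    by (simp add: subalgebra_def path_filtration_def)
qed

section \<open>Markov property, semigroup and contraction of the transition operators\<close>

locale circle_diffusion =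
  fixes D :: "(circle \<Rightarrow> real) set"
    and L :: "(circle \<Rightarrow> real) \<Rightarrow> circle \<Rightarrow> real"
    and P :: "circle \<Rightarrow> (real \<Rightarrow> circle) measure"
  assumes diffusion: "diffusion_with_generator D L P"
begin

lemma kernel_measurable: "P \<in> borel \<rightarrow>\<^sub>M prob_algebra path_space"
  using diffusion by (simp add: diffusion_with_generator_def)

lemma sets_P: "sets (P x) = sets path_space" and prob_space_P: "prob_space (P x)"
  using measurable_space[OF kernel_measurable, of x] by (auto simp: space_prob_algebra)

lemma measurable_P: "measurable (P x) N = measurable path_space N"
  by (rule measurable_cong_sets[OF sets_P refl])

lemma space_P: "space (P x) = space path_space"
  by (rule sets_eq_imp_space_eq[OF sets_P])

lemma starts_at: "AE w in P x. w 0 = x"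
  using diffusion by (simp add: diffusion_with_generator_def)

lemma integrable_P_bounded:
  fixes F :: "(real \<Rightarrow> circle) \<Rightarrow> real"
  assumes "F \<in> borel_measurable path_space" "\<And>w. w \<in> space path_space \<Longrightarrow> \<bar>F w\<bar> \<le> C"
  shows "integrable (P x) F"
  using assms
  by (intro finite_measure.integrable_const_bound[of _ _ C]
        prob_space.finite_measure prob_space_P)
     (auto simp: measurable_P space_P)

lemma measurable_eval:
  assumes "f \<in> bounded_borel" "0 \<le> t"
  shows "(\<lambda>w. f (w t)) \<in> borel_measurable path_space"
  using measurable_compose[OF measurable_coordinate[OF assms(2)] bounded_borel_measurable[OF assms(1)]] .

lemma integrable_eval:
  assumes "f \<in> bounded_borel" "0 \<le> t"
  shows "integrable (P x) (\<lambda>w. f (w t))"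
proof -
  obtain C where "\<And>x. \<bar>f x\<bar> \<le> C" using assms(1) by (rule bounded_borelE) blast
  with measurable_eval[OF assms] show ?thesis
    by (rule integrable_P_bounded)
qed

lemma transition_op_add:
  assumes "f \<in> bounded_borel" "g \<in> bounded_borel" "0 \<le> t"
  shows "transition_op P t (\<lambda>x. f x + g x) x = transition_op P t f x + transition_op P t g x"
  unfolding transition_op_def using assms by (intro Bochner_Integration.integral_add integrable_eval)

lemma transition_op_cmult:
  "transition_op P t (\<lambda>x. c * f x) x = c * transition_op P t f x"
  by (simp add: transition_op_def)

text \<open>Averaging against a probability law cannot increase a uniform bound. The form with a
  difference serves both error estimates and, with \<open>g\<close> zero, plain bounds.\<close>

lemma transition_op_contraction:
  assumes "f \<in> bounded_borel" "g \<in> bounded_borel" "0 \<le> t" "\<And>x. \<bar>f x - g x\<bar> \<le> C"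
  shows "\<bar>transition_op P t f x - transition_op P t g x\<bar> \<le> C"
proof -
  interpret prob_space "P x" by (rule prob_space_P)
  have "transition_op P t f x - transition_op P t g x = (\<integral>w. f (w t) - g (w t) \<partial>P x)"
    unfolding transition_op_def using assms(1-3)
    by (intro Bochner_Integration.integral_diff[symmetric] integrable_eval)
  also have "\<bar>\<dots>\<bar> \<le> (\<integral>w. \<bar>f (w t) - g (w t)\<bar> \<partial>P x)"
    by (rule integral_abs_bound)
  also have "\<dots> \<le> C"
    using assms by (intro integral_le_const integrable_abs Bochner_Integration.integrable_diff integrable_eval) auto
  finally show ?thesis .
qed

lemma bounded_borel_transition_op:
  assumes "f \<in> bounded_borel" "0 \<le> t"
  shows "transition_op P t f \<in> bounded_borel"
proof -
  obtain C where C: "\<And>x. \<bar>f x\<bar> \<le> C" using assms(1) by (rule bounded_borelE) blast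
  show ?thesis
  proof (rule bounded_borelI)
    show "transition_op P t f \<in> borel_measurable borel"
      \<comment> \<open>Measurability in the starting point comes from \<open>P\<close> being a
        measurable kernel.\<close>
      unfolding transition_op_def
      using measurable_compose[OF measurable_prob_algebraD[OF kernel_measurable]
        integral_measurable_subprob_algebra[OF measurable_eval[OF assms]]] .
    show "\<bar>transition_op P t f x\<bar> \<le> C" for x
      using transition_op_contraction[OF assms(1) bounded_borel_const[of 0] assms(2), of C] C
      by (simp add: transition_op_def)
  qed
qed

text \<open>The integrated form of the Markov property: a bounded weight \<open>Z\<close> depending
  on the past up to \<open>s\<close> passes through the conditional expectation, which is then
  replaced by its almost sure value.\<close>

lemma markov:
  assumes f: "f \<in> bounded_borel" and s: "0 \<le> s" and t: "0 \<le> t"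
    and Z: "Z \<in> borel_measurable (path_filtration s)"
    and Z_bound: "\<And>w. w \<in> space path_space \<Longrightarrow> \<bar>Z w\<bar> \<le> C"
  shows "(\<integral>w. Z w * f (w (s + t)) \<partial>P x) = (\<integral>w. Z w * transition_op P t f (w s) \<partial>P x)"
proof -
  interpret finite_measure_subalgebra "P x" "path_filtration s"
    unfolding finite_measure_subalgebra_def finite_measure_subalgebra_axioms_def
    using subalgebra_path_filtration[OF sets_P] prob_space.finite_measure[OF prob_space_P] by blast
  have fm: "(\<lambda>w. f (w (s + t))) \<in> borel_measurable (P x)"
    using measurable_eval[OF f, of "s + t"] s t by (simp add: measurable_P)
  have Zm: "Z \<in> borel_measurable (P x)"
    by (rule measurable_from_subalg[OF subalg Z])
  obtain B where B: "\<And>x. \<bar>f x\<bar> \<le> B" using f by (rule bounded_borelE) blast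
  have "integrable (P x) (\<lambda>w. Z w * f (w (s + t)))"
  proof (rule integrable_P_bounded)
    show "(\<lambda>w. Z w * f (w (s + t))) \<in> borel_measurable path_space"
      using fm Zm by (simp add: measurable_P)
    show "\<bar>Z w * f (w (s + t))\<bar> \<le> C * B" if "w \<in> space path_space" for w
      using mult_mono[OF Z_bound[OF that] B] Z_bound[OF that] abs_ge_zero[of "Z w"]
      by (simp add: abs_mult)
  qed
  from real_cond_exp_intg(2)[OF this Z fm]
  have "(\<integral>w. Z w * f (w (s + t)) \<partial>P x) =
      (\<integral>w. Z w * real_cond_exp (P x) (path_filtration s) (\<lambda>w. f (w (s + t))) w \<partial>P x)"
    by simp
  also have "\<dots> = (\<integral>w. Z w * transition_op P t f (w s) \<partial>P x)"
  proof (rule integral_cong_AE)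
    show "(\<lambda>w. Z w * real_cond_exp (P x) (path_filtration s) (\<lambda>w. f (w (s + t))) w)
        \<in> borel_measurable (P x)"
      using Zm by simp
    show "(\<lambda>w. Z w * transition_op P t f (w s)) \<in> borel_measurable (P x)"
      using Zm measurable_eval[OF bounded_borel_transition_op[OF f t] s]
      by (simp add: measurable_P)
    have "AE w in P x. real_cond_exp (P x) (path_filtration s) (\<lambda>w. f (w (s + t))) w
        = transition_op P t f (w s)"
      using diffusion f s t by (auto simp: diffusion_with_generator_def bounded_borel_def)
    then show "AE w in P x. Z w * real_cond_exp (P x) (path_filtration s) (\<lambda>w. f (w (s + t))) w
        = Z w * transition_op P t f (w s)"
      by eventually_elim simp
  qed
  finally show ?thesis .
qed

lemma transition_op_semigroup:
  assumes "f \<in> bounded_borel" "0 \<le> s" "0 \<le> t"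
  shows "transition_op P (s + t) f x = transition_op P s (transition_op P t f) x"
  using markov[OF assms, of "\<lambda>_. 1" 1 x] by (simp add: transition_op_def)

lemma transition_op_0:
  assumes "f \<in> bounded_borel"
  shows "transition_op P 0 f x = f x"
proof -
  interpret prob_space "P x" by (rule prob_space_P)
  have "transition_op P 0 f x = (\<integral>w. f x \<partial>P x)"
    unfolding transition_op_def
  proof (rule integral_cong_AE)
    show "(\<lambda>w. f (w 0)) \<in> borel_measurable (P x)"
      using measurable_eval[OF assms order_refl] by (simp add: measurable_P)
    show "AE w in P x. f (w 0) = f x"
      using starts_at[of x] by eventually_elim simp
  qed simp
  then show ?thesis
    by (simp add: prob_space)
qed

text \<open>The difference quotients at 0 of \<open>transition_op P h e\<close> and of
  \<open>exp (- l * h) * e\<close> both tend to \<open>- l * e\<close>, uniformly in the point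
  because the generator is taken in supremum norm and \<open>e\<close> is bounded. Their difference
  is therefore \<open>o(h)\<close> uniformly.\<close>

lemma transition_op_eigenfunction_near:
  assumes e: "e \<in> D" "e \<in> bounded_borel" "\<And>x. L e x = - l * e x" and "0 < \<epsilon>"
  shows "\<forall>\<^sub>F h in at_right 0. \<forall>x. \<bar>transition_op P h e x - exp (- l * h) * e x\<bar> \<le> \<epsilon> * h"
proof -
  obtain C where C: "\<And>x. \<bar>e x\<bar> \<le> C" using e(2) by (rule bounded_borelE) blast
  have "0 \<le> C" using C[of undefined] by linarith
  \<comment> \<open>Half of the error budget goes to the scalar exponential, whose error is
    multiplied by at most \<open>C\<close>; adding 1 keeps the denominator positive.\<close>
  define \<eta> where "\<eta> = \<epsilon> / (2 * (C + 1))"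
  have \<eta>: "0 < \<eta>" "C * \<eta> \<le> \<epsilon> / 2"
    using \<open>0 < \<epsilon>\<close> \<open>0 \<le> C\<close> by (auto simp: \<eta>_def field_simps)
  have "uniform_limit UNIV (\<lambda>t x. (transition_op P t e x - e x) / t) (L e) (at_right 0)"
    using diffusion e(1) by (simp add: diffusion_with_generator_def)
  then have 1: "\<forall>\<^sub>F h in at_right 0. \<forall>x. \<bar>(transition_op P h e x - e x) / h - L e x\<bar> < \<epsilon> / 2"
    using \<open>0 < \<epsilon>\<close> unfolding uniform_limit_iff dist_real_def by (auto dest: spec[of _ "\<epsilon> / 2"])
  have "((\<lambda>h. exp (- l * h)) has_field_derivative - l) (at 0)"
    by (rule derivative_eq_intros refl | simp)+
  then have "((\<lambda>h. (exp (- l * h) - 1) / h) \<longlongrightarrow> - l) (at_right 0)"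
    by (auto simp: has_field_derivative_iff intro: filterlim_mono at_le)
  then have 2: "\<forall>\<^sub>F h in at_right 0. \<bar>(exp (- l * h) - 1) / h - (- l)\<bar> < \<eta>"
    using \<eta>(1) unfolding tendsto_iff dist_real_def by blast
  show ?thesis
    using 1 2 eventually_at_right_less
  proof eventually_elim
    case (elim h)
    show ?case
    proof
      fix x
      have "(transition_op P h e x - exp (- l * h) * e x) / h =
          ((transition_op P h e x - e x) / h - L e x) - ((exp (- l * h) - 1) / h - (- l)) * e x"
        using elim(3) by (simp add: e(3) field_simps)
      also have "\<bar>\<dots>\<bar> \<le> \<bar>(transition_op P h e x - e x) / h - L e x\<bar>
          + \<bar>(exp (- l * h) - 1) / h - (- l)\<bar> * \<bar>e x\<bar>"
        by (metis abs_mult abs_triangle_ineq4)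
      also have "\<dots> \<le> \<epsilon> / 2 + \<eta> * C"
        using elim(1,2) C[of x] by (intro add_mono mult_mono) (auto intro: less_imp_le)
      also have "\<dots> \<le> \<epsilon>"
        using \<eta>(2) by (simp add: mult.commute)
      finally show "\<bar>transition_op P h e x - exp (- l * h) * e x\<bar> \<le> \<epsilon> * h"
        using elim(3) by (simp add: abs_divide field_simps)
    qed
  qed
qed

text \<open>The error \<open>\<bar>P\<^sub>t e - exp (- l t) e\<bar>\<close> is subadditive in \<open>t\<close> because the transition operators are
  contractions, and it is \<open>o(t)\<close> at \<open>0\<close>; hence it vanishes.\<close>

lemma transition_op_eigenfunction:
  assumes e: "e \<in> D" "e \<in> bounded_borel" "\<And>x. L e x = - l * e x" and "0 \<le> l" "0 < t"
  shows "transition_op P t e x = exp (- l * t) * e x"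
proof -
  have "\<bar>transition_op P t e x - exp (- l * t) * e x\<bar> \<le> \<epsilon> * t" if \<epsilon>: "0 < \<epsilon>" for \<epsilon>
  proof -
    obtain b where "0 < b" and b: "\<And>h x. 0 < h \<Longrightarrow> h < b \<Longrightarrow>
        \<bar>transition_op P h e x - exp (- l * h) * e x\<bar> \<le> \<epsilon> * h"
      using transition_op_eigenfunction_near[OF e \<epsilon>] unfolding eventually_at_right_field
      by auto
    \<comment> \<open>The time \<open>t\<close> is cut into \<open>N\<close> equal steps, each short
      enough for the local estimate.\<close>
    obtain N where N: "t < of_nat N * b"
      using ex_less_of_nat_mult[OF \<open>0 < b\<close>] by blast
    define h where "h = t / N"
    have "0 < N" using N \<open>0 < t\<close> by (cases N) auto
    then have h: "0 < h" "h < b" "N * h = t"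
      using N \<open>0 < t\<close> by (auto simp: h_def field_simps)
    have "\<bar>transition_op P (n * h) e x - exp (- l * (n * h)) * e x\<bar> \<le> \<epsilon> * (n * h)" for n :: nat and x
    proof (induction n arbitrary: x)
      case 0
      then show ?case by (simp add: transition_op_0[OF e(2)])
    next
      case (Suc n)
      let ?c = "exp (- l * h)"
      have c: "0 \<le> ?c" "?c \<le> 1" using \<open>0 \<le> l\<close> h(1) by auto
      \<comment> \<open>Telescoping: the first difference is the local error carried through the
        contraction \<open>transition_op P (n * h)\<close>. The second is the accumulated error
        times \<open>?c\<close>, which is at most 1 because \<open>l\<close> is nonnegative.\<close>
      have "transition_op P (Suc n * h) e x - exp (- l * (Suc n * h)) * e x =
          (transition_op P (n * h) (transition_op P h e) x
            - transition_op P (n * h) (\<lambda>y. ?c * e y) x)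
          + ?c * (transition_op P (n * h) e x - exp (- l * (n * h)) * e x)"
        using transition_op_semigroup[OF e(2), of "n * h" h x] h(1)
        unfolding transition_op_cmult by (simp add: algebra_simps flip: exp_add)
      also have "\<bar>\<dots>\<bar> \<le> \<epsilon> * h + 1 * (\<epsilon> * (n * h))"
      proof (rule order_trans[OF abs_triangle_ineq add_mono])
        show "\<bar>transition_op P (n * h) (transition_op P h e) x
            - transition_op P (n * h) (\<lambda>y. ?c * e y) x\<bar> \<le> \<epsilon> * h"
          using b[OF h(1,2)] h(1) e(2)
          by (intro transition_op_contraction bounded_borel_transition_op bounded_borel_mult
              bounded_borel_const) auto
        show "\<bar>?c * (transition_op P (n * h) e x - exp (- l * (n * h)) * e x)\<bar> \<le> 1 * (\<epsilon> * (n * h))"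
          unfolding abs_mult using c by (intro mult_mono Suc.IH) auto
      qed
      finally show ?case by (simp add: algebra_simps)
    qed
    from this[of N x] show ?thesis by (simp add: h(3))
  qed
  then have "\<bar>transition_op P t e x - exp (- l * t) * e x\<bar> \<le> 0 + \<epsilon>" if "0 < \<epsilon>" for \<epsilon>
    \<comment> \<open>Applying the bound to \<open>\<epsilon> / t\<close> removes the factor
      \<open>t\<close>.\<close>
    using \<open>0 < t\<close> that by (auto dest!: meta_spec[of _ "\<epsilon> / t"])
  then have "\<bar>transition_op P t e x - exp (- l * t) * e x\<bar> \<le> 0"
    by (rule field_le_epsilon)
  then show ?thesis by simp
qed

lemma uniform_limit_transition_op:
  assumes "\<And>n. F n \<in> bounded_borel" "f \<in> bounded_borel" "0 \<le> t" "uniform_limit UNIV F f K"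
  shows "uniform_limit UNIV (\<lambda>n. transition_op P t (F n)) (transition_op P t f) K"
proof (rule uniform_limitI)
  fix \<epsilon> :: real assume "0 < \<epsilon>"
  \<comment> \<open>The contraction yields only a weak inequality, so the margin is halved to
    recover a strict one.\<close>
  then have "\<forall>\<^sub>F n in K. \<forall>x\<in>UNIV. dist (F n x) (f x) < \<epsilon> / 2"
    using assms(4) unfolding uniform_limit_iff by (meson half_gt_zero)
  then show "\<forall>\<^sub>F n in K. \<forall>x\<in>UNIV. dist (transition_op P t (F n) x) (transition_op P t f x) < \<epsilon>"
  proof eventually_elim
    case (elim n)
    then have "\<bar>transition_op P t (F n) x - transition_op P t f x\<bar> \<le> \<epsilon> / 2" for x
      using assms(1-3) by (intro transition_op_contraction) (auto simp: dist_real_def less_imp_le)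
    moreover have "\<epsilon> / 2 < \<epsilon>"
      using \<open>0 < \<epsilon>\<close> by simp
    ultimately show ?case
      unfolding dist_real_def by (blast intro: le_less_trans)
  qed
qed

text \<open>With \<open>W = exp (h * V)\<close> this is one step of the Lie-Trotter product for the
  Feynman-Kac semigroup of \<open>L + V\<close>: multiply, then let the diffusion run for time
  \<open>h\<close>.\<close>

definition twisted_op :: "real \<Rightarrow> (circle \<Rightarrow> real) \<Rightarrow> (circle \<Rightarrow> real) \<Rightarrow> circle \<Rightarrow> real" where
  "twisted_op h W f = transition_op P h (\<lambda>y. W y * f y)"

lemma prod_path_bound:
  fixes W :: "circle \<Rightarrow> real"
  assumes "\<And>y. \<bar>W y\<bar> \<le> C"
  shows "\<bar>\<Prod>i\<le>n. W (w (real i * h))\<bar> \<le> C ^ Suc n"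
proof -
  have "(\<Prod>i\<le>n. \<bar>W (w (real i * h))\<bar>) \<le> (\<Prod>i\<le>n. C)"
    using assms by (intro prod_mono) auto
  then show ?thesis by (simp add: abs_prod)
qed

text \<open>The last time step is peeled off by the Markov property, which replaces the final factor
  and \<open>f\<close> by \<open>twisted_op h W f\<close> one step earlier; hence the induction
  leaves \<open>f\<close> arbitrary. The \<open>n + 1\<close> sampling times surround
  \<open>n\<close> steps, so one factor \<open>W x\<close> from time 0 remains in front.\<close>

lemma integral_path_product:
  assumes W: "W \<in> bounded_borel" and h: "0 \<le> h" and f: "f \<in> bounded_borel"
  shows "(\<integral>w. (\<Prod>i\<le>n. W (w (real i * h))) * f (w (n * h)) \<partial>P x) = W x * (twisted_op h W ^^ n) f x"
  using f
proof (induction n arbitrary: f)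
  case 0
  then show ?case
    using transition_op_0[OF bounded_borel_mult[OF W 0]] by (simp add: transition_op_def)
next
  case (Suc n)
  obtain C where C: "\<And>y. \<bar>W y\<bar> \<le> C" using W by (rule bounded_borelE) blast
  have Wf: "(\<lambda>y. W y * f y) \<in> bounded_borel"
    by (rule bounded_borel_mult[OF W Suc.prems])
  have meas: "(\<lambda>w. \<Prod>i\<le>n. W (w (real i * h))) \<in> borel_measurable (path_filtration (n * h))"
    using h by (intro borel_measurable_prod
        measurable_compose[OF measurable_coordinate_filtration bounded_borel_measurable[OF W]])
      (auto intro: mult_right_mono)
  have "(\<integral>w. (\<Prod>i\<le>Suc n. W (w (real i * h))) * f (w (Suc n * h)) \<partial>P x) =
      (\<integral>w. (\<Prod>i\<le>n. W (w (real i * h))) * (W (w (n * h + h)) * f (w (n * h + h))) \<partial>P x)"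
    by (simp add: algebra_simps)
  also have "\<dots> = (\<integral>w. (\<Prod>i\<le>n. W (w (real i * h))) * twisted_op h W f (w (n * h)) \<partial>P x)"
    unfolding twisted_op_def
    using markov[OF Wf _ h meas prod_path_bound[OF C]] h by simp
  also have "\<dots> = W x * (twisted_op h W ^^ n) (twisted_op h W f) x"
    by (rule Suc.IH) (simp add: twisted_op_def bounded_borel_transition_op Wf h)
  finally show ?case
    \<comment> \<open>The induction adds the new operator innermost, whereas \<open>funpow\<close>
      unfolds it outermost.\<close>
    by (simp add: funpow_swap1)
qed

end

section \<open>Symmetry with respect to a reversible measure\<close>

text \<open>The difference of the integrals is at most the uniform distance of \<open>F n\<close>
  and \<open>f\<close> times the integral of \<open>\<bar>g\<bar>\<close>, which is finite because
  \<open>M\<close> is.\<close>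

lemma tendsto_integral_uniform_mult:
  fixes f g :: "'a::topological_space \<Rightarrow> real"
  assumes M: "finite_measure M" "sets M = sets borel"
    and F: "\<And>n. F n \<in> bounded_borel" "f \<in> bounded_borel" "g \<in> bounded_borel"
    and lim: "uniform_limit UNIV F f sequentially"
  shows "(\<lambda>n. \<integral>x. F n x * g x \<partial>M) \<longlonglongrightarrow> (\<integral>x. f x * g x \<partial>M)"
proof (rule LIMSEQ_I)
  fix r :: real assume "0 < r"
  define K where "K = (\<integral>x. \<bar>g x\<bar> \<partial>M)"
  have "0 \<le> K" by (simp add: K_def)
  define \<eta> where "\<eta> = r / (2 * (K + 1))"
  have \<eta>: "0 < \<eta>" "\<eta> * K < r"
    using \<open>0 < r\<close> \<open>0 \<le> K\<close> by (auto simp: \<eta>_def field_simps intro: add_nonneg_pos)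
  obtain N where N: "\<And>n x. n \<ge> N \<Longrightarrow> \<bar>F n x - f x\<bar> < \<eta>"
    using lim \<eta>(1) unfolding uniform_limit_iff eventually_sequentially dist_real_def by blast
  have int: "integrable M (\<lambda>x. u x * v x)" if "u \<in> bounded_borel" "v \<in> bounded_borel" for u v
    by (rule integrable_bounded_borel[OF M(1) bounded_borel_mult[OF that] M(2)])
  have int_g: "integrable M g"
    by (rule integrable_bounded_borel[OF M(1) F(3) M(2)])
  have "norm ((\<integral>x. F n x * g x \<partial>M) - (\<integral>x. f x * g x \<partial>M)) < r" if "n \<ge> N" for n
  proof -
    have "(\<integral>x. F n x * g x \<partial>M) - (\<integral>x. f x * g x \<partial>M) = (\<integral>x. F n x * g x - f x * g x \<partial>M)"
      using F by (intro Bochner_Integration.integral_diff[symmetric] int)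
    also have "\<bar>\<dots>\<bar> \<le> (\<integral>x. \<bar>F n x * g x - f x * g x\<bar> \<partial>M)"
      by (rule integral_abs_bound)
    also have "\<dots> \<le> (\<integral>x. \<eta> * \<bar>g x\<bar> \<partial>M)"
    proof (rule integral_mono)
      show "integrable M (\<lambda>x. \<bar>F n x * g x - f x * g x\<bar>)"
        using F by (intro integrable_abs Bochner_Integration.integrable_diff int)
      show "\<bar>F n x * g x - f x * g x\<bar> \<le> \<eta> * \<bar>g x\<bar>" for x
        using N[OF that, of x] by (simp add: abs_mult mult_right_mono less_imp_le flip: left_diff_distrib)
    qed (use int_g in auto)
    also have "\<dots> = \<eta> * K" by (simp add: K_def)
    also have "\<dots> < r" by (rule \<eta>(2))
    finally show ?thesis by simp
  qed
  then show "\<exists>N. \<forall>n\<ge>N. norm ((\<integral>x. F n x * g x \<partial>M) - (\<integral>x. f x * g x \<partial>M)) < r"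
    by blast
qed

locale reversible_circle_diffusion = circle_diffusion C2_circle half_laplacian P
  for P :: "circle \<Rightarrow> (real \<Rightarrow> circle) measure" +
  fixes \<mu> :: "circle measure"
  assumes sets_\<mu>: "sets \<mu> = sets borel"
    and finite_\<mu>: "finite_measure \<mu>"
    and selfadjoint: "selfadjoint_in_L2 C2_circle half_laplacian \<mu>"
begin

section \<open>Feller property and symmetry of the transition operators\<close>

lemma transition_op_wave:
  assumes "0 < t"
  shows "transition_op P t (wave a k \<theta>) x = exp (- (2 * (pi * of_int k)\<^sup>2) * t) * wave a k \<theta> x"
  using assms
  by (intro transition_op_eigenfunction)
    (auto simp: wave_in_C2_circle half_laplacian_wave bounded_borel_continuous_circle continuous_on_wave)

lemma bounded_borel_trigonometric: "trigonometric f \<Longrightarrow> f \<in> bounded_borel"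
  by (simp add: bounded_borel_continuous_circle continuous_on_trigonometric)

lemma integrable_\<mu>:
  assumes "f \<in> bounded_borel" "g \<in> bounded_borel"
  shows "integrable \<mu> (\<lambda>x. f x * g x)"
  by (rule integrable_bounded_borel[OF finite_\<mu> bounded_borel_mult[OF assms] sets_\<mu>])

text \<open>The Feller property: waves are only rescaled, so trigonometric polynomials keep
  continuous images, and the contraction carries uniform limits over. It keeps the iterates of
  \<open>twisted_op\<close> within the functions to which symmetry applies.\<close>

lemma continuous_on_transition_op:
  assumes "continuous_on UNIV f" "0 < t"
  shows "continuous_on UNIV (transition_op P t f)"
proof -
  obtain F where F: "\<And>n. trigonometric (F n)" "uniform_limit UNIV F f sequentially"
    using trigonometric_dense[OF assms(1)] by blast
  have trig: "continuous_on UNIV (transition_op P t g)" if "trigonometric g" for g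
    using that
  proof (induction rule: trigonometric.induct)
    case (wave a k \<theta>)
    have "transition_op P t (wave a k \<theta>) = (\<lambda>x. exp (- (2 * (pi * of_int k)\<^sup>2) * t) * wave a k \<theta> x)"
      using transition_op_wave[OF assms(2)] by blast
    then show ?case
      by (simp add: continuous_on_mult_left continuous_on_wave)
  next
    case (add g h)
    have "transition_op P t (\<lambda>x. g x + h x) = (\<lambda>x. transition_op P t g x + transition_op P t h x)"
      using add.hyps assms(2)
      by (intro ext transition_op_add bounded_borel_trigonometric) auto
    with add.IH show ?case
      by (simp add: continuous_on_add)
  qed
  have "uniform_limit UNIV (\<lambda>n. transition_op P t (F n)) (transition_op P t f) sequentially"
    using F assms by (intro uniform_limit_transition_op bounded_borel_trigonometric
        bounded_borel_continuous_circle) auto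
  then show ?thesis
    by (rule uniform_limit_theorem[rotated]) (simp_all add: trig F(1))
qed

lemma transition_op_symmetric_wave:
  assumes "0 < t"
  shows "(\<integral>x. transition_op P t (wave a k \<theta>) x * wave b l \<phi> x \<partial>\<mu>) =
    (\<integral>x. wave a k \<theta> x * transition_op P t (wave b l \<phi>) x \<partial>\<mu>)"
proof -
  define I where "I = (\<integral>x. wave a k \<theta> x * wave b l \<phi> x \<partial>\<mu>)"
  have scale: "(\<integral>x. c * wave a k \<theta> x * wave b l \<phi> x \<partial>\<mu>) = c * I"
    "(\<integral>x. wave a k \<theta> x * (c * wave b l \<phi> x) \<partial>\<mu>) = c * I" for c
    unfolding I_def by (simp_all add: mult.assoc mult.left_commute)
  have "(\<integral>x. half_laplacian (wave a k \<theta>) x * wave b l \<phi> x \<partial>\<mu>) =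
      (\<integral>x. wave a k \<theta> x * half_laplacian (wave b l \<phi>) x \<partial>\<mu>)"
    using selfadjoint wave_in_C2_circle unfolding selfadjoint_in_L2_def by blast
  \<comment> \<open>Selfadjointness says that the difference of the eigenvalues times
    \<open>I\<close> is zero. Either both sides of the goal vanish, or the two damping factors
    agree.\<close>
  then have "I = 0 \<or> 2 * (pi * of_int k)\<^sup>2 = 2 * (pi * of_int l)\<^sup>2"
    unfolding half_laplacian_wave scale by auto
  then show ?thesis
    unfolding transition_op_wave[OF assms] scale by auto
qed

text \<open>Both sides are bilinear, so symmetry on waves extends to sums, first in the right
  argument and then in the left.\<close>

lemma transition_op_symmetric_trigonometric:
  assumes "trigonometric f" "trigonometric g" "0 < t"
  shows "(\<integral>x. transition_op P t f x * g x \<partial>\<mu>) = (\<integral>x. f x * transition_op P t g x \<partial>\<mu>)"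
proof -
  have bb: "u \<in> bounded_borel" "transition_op P t u \<in> bounded_borel" if "trigonometric u" for u
    using that assms(3) by (auto intro: bounded_borel_trigonometric bounded_borel_transition_op)
  have op_add: "transition_op P t (\<lambda>x. u x + v x) x = transition_op P t u x + transition_op P t v x"
    if "trigonometric u" "trigonometric v" for u v x
    using that assms(3) by (intro transition_op_add bb) auto
  have wave_left: "(\<integral>x. transition_op P t (wave a k \<theta>) x * g x \<partial>\<mu>) =
      (\<integral>x. wave a k \<theta> x * transition_op P t g x \<partial>\<mu>)" for a k \<theta>
    using assms(2)
  proof (induction rule: trigonometric.induct)
    case (wave b l \<phi>)
    then show ?case by (rule transition_op_symmetric_wave[OF assms(3)])
  next
    case (add u v)
    then show ?case
      by (simp add: op_add distrib_left bb integrable_\<mu> trigonometric.wave)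
  qed
  show ?thesis
    using assms(1)
  proof (induction rule: trigonometric.induct)
    case (wave a k \<theta>)
    then show ?case by (rule wave_left)
  next
    case (add u v)
    then show ?case
      by (simp add: op_add distrib_right bb assms(2) integrable_\<mu>)
  qed
qed

lemma transition_op_symmetric_limit:
  assumes F: "\<And>n. F n \<in> bounded_borel" "f \<in> bounded_borel" "uniform_limit UNIV F f sequentially"
    and g: "g \<in> bounded_borel" and t: "0 < t"
    and sym: "\<And>n. (\<integral>x. transition_op P t (F n) x * g x \<partial>\<mu>) = (\<integral>x. F n x * transition_op P t g x \<partial>\<mu>)"
  shows "(\<integral>x. transition_op P t f x * g x \<partial>\<mu>) = (\<integral>x. f x * transition_op P t g x \<partial>\<mu>)"
proof (rule LIMSEQ_unique)
  show "(\<lambda>n. \<integral>x. transition_op P t (F n) x * g x \<partial>\<mu>) \<longlonglongrightarrow> (\<integral>x. transition_op P t f x * g x \<partial>\<mu>)"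
    using t by (intro tendsto_integral_uniform_mult[OF finite_\<mu> sets_\<mu>] F g
        bounded_borel_transition_op uniform_limit_transition_op) auto
  show "(\<lambda>n. \<integral>x. transition_op P t (F n) x * g x \<partial>\<mu>) \<longlonglongrightarrow> (\<integral>x. f x * transition_op P t g x \<partial>\<mu>)"
    unfolding sym
    using t by (intro tendsto_integral_uniform_mult[OF finite_\<mu> sets_\<mu>] F g
        bounded_borel_transition_op) auto
qed

text \<open>The arguments are approximated one at a time. A limit in the left argument handles a
  trigonometric \<open>v\<close> on the right; exchanging the factors of each product then allows a
  limit in the other argument.\<close>

lemma transition_op_symmetric:
  assumes f: "continuous_on UNIV f" and g: "continuous_on UNIV g" and t: "0 < t"
  shows "(\<integral>x. transition_op P t f x * g x \<partial>\<mu>) = (\<integral>x. f x * transition_op P t g x \<partial>\<mu>)"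
proof -
  have trig: "(\<integral>x. transition_op P t u x * v x \<partial>\<mu>) = (\<integral>x. u x * transition_op P t v x \<partial>\<mu>)"
    if uv: "continuous_on UNIV u" "trigonometric v" for u v
  proof -
    obtain F where F: "\<And>n. trigonometric (F n)" "uniform_limit UNIV F u sequentially"
      using trigonometric_dense[OF uv(1)] by blast
    show ?thesis
      by (rule transition_op_symmetric_limit[OF _ _ F(2) _ t])
        (simp_all add: F(1) uv bounded_borel_trigonometric bounded_borel_continuous_circle
          transition_op_symmetric_trigonometric t)
  qed
  obtain G where G: "\<And>n. trigonometric (G n)" "uniform_limit UNIV G g sequentially"
    using trigonometric_dense[OF g] by blast
  have "(\<integral>x. transition_op P t g x * f x \<partial>\<mu>) = (\<integral>x. g x * transition_op P t f x \<partial>\<mu>)"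
  proof (rule transition_op_symmetric_limit[OF _ _ G(2) _ t])
    show "(\<integral>x. transition_op P t (G n) x * f x \<partial>\<mu>) = (\<integral>x. G n x * transition_op P t f x \<partial>\<mu>)" for n
      using trig[OF f G(1)[of n]] by (simp add: mult.commute)
  qed (simp_all add: G(1) f g bounded_borel_trigonometric bounded_borel_continuous_circle)
  then show ?thesis
    by (simp add: mult.commute)
qed

section \<open>Symmetry of the discretised Feynman-Kac operators\<close>

lemma continuous_on_twisted_op:
  assumes "continuous_on UNIV W" "continuous_on UNIV f" "0 < h"
  shows "continuous_on UNIV ((twisted_op h W ^^ n) f)"
  by (induction n)
    (auto simp: twisted_op_def assms intro!: continuous_on_transition_op continuous_on_mult)

text \<open>The operator \<open>twisted_op h W\<close> is symmetric for the bilinear form with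
  weight \<open>W\<close> against \<mu>: the leading \<open>W\<close> joins \<open>g\<close>, and
  symmetry of the transition operator moves it across. Iteration moves one factor at a time, so
  \<open>g\<close> varies in the induction.\<close>

lemma twisted_op_symmetric:
  assumes W: "continuous_on UNIV W" and "continuous_on UNIV f" "continuous_on UNIV g" and h: "0 < h"
  shows "(\<integral>x. W x * (twisted_op h W ^^ n) f x * g x \<partial>\<mu>) = (\<integral>x. W x * f x * (twisted_op h W ^^ n) g x \<partial>\<mu>)"
  using assms(2,3)
proof (induction n arbitrary: g)
  case (Suc n)
  have cont: "continuous_on UNIV (twisted_op h W g)"
    using continuous_on_twisted_op[OF W Suc.prems(2) h, of 1] by simp
  have "(\<integral>x. W x * (twisted_op h W ^^ Suc n) f x * g x \<partial>\<mu>) =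
      (\<integral>x. transition_op P h (\<lambda>y. W y * (twisted_op h W ^^ n) f y) x * (W x * g x) \<partial>\<mu>)"
    by (simp add: twisted_op_def mult_ac)
  also have "\<dots> = (\<integral>x. W x * (twisted_op h W ^^ n) f x * twisted_op h W g x \<partial>\<mu>)"
    unfolding twisted_op_def[of h W g]
    by (intro transition_op_symmetric continuous_on_mult W Suc.prems h continuous_on_twisted_op)
  also have "\<dots> = (\<integral>x. W x * f x * (twisted_op h W ^^ n) (twisted_op h W g) x \<partial>\<mu>)"
    by (rule Suc.IH[OF Suc.prems(1) cont])
  finally show ?case
    by (simp add: funpow_swap1)
qed simp

end

section \<open>Passage to the limit\<close>

text \<open>The sum samples both endpoints, which gives the palindromic product. It is the left
  Riemann sum plus one term of size \<open>O(1 / n)\<close>; the left sum converges by uniform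
  continuity, with an error of at most \<open>\<epsilon> * h\<close> per cell.\<close>

lemma riemann_sum_tendsto_integral:
  fixes \<phi> :: "real \<Rightarrow> real"
  assumes t: "0 < t" and cont: "continuous_on {0..t} \<phi>"
  shows "(\<lambda>n. \<Sum>i\<le>Suc n. t / Suc n * \<phi> (i * (t / Suc n))) \<longlonglongrightarrow> integral {0..t} \<phi>"
proof -
  have "(\<lambda>n. \<Sum>i<Suc n. t / Suc n * \<phi> (i * (t / Suc n))) \<longlonglongrightarrow> integral {0..t} \<phi>"
  proof (rule LIMSEQ_I)
    fix r :: real assume "0 < r"
    define \<epsilon> where "\<epsilon> = r / (2 * t)"
    have \<epsilon>: "0 < \<epsilon>" "\<epsilon> * t < r"
      using \<open>0 < r\<close> t by (auto simp: \<epsilon>_def)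
    have "uniformly_continuous_on {0..t} \<phi>"
      by (rule compact_uniformly_continuous[OF cont compact_Icc])
    then obtain d where "0 < d" and d: "\<And>a b. a \<in> {0..t} \<Longrightarrow> b \<in> {0..t} \<Longrightarrow> \<bar>a - b\<bar> < d \<Longrightarrow> \<bar>\<phi> a - \<phi> b\<bar> < \<epsilon>"
      using \<epsilon>(1) unfolding uniformly_continuous_on_def dist_real_def by metis
    obtain N where N: "t < of_nat N * d"
      using ex_less_of_nat_mult[OF \<open>0 < d\<close>] by blast
    have "norm ((\<Sum>i<Suc n. t / Suc n * \<phi> (i * (t / Suc n))) - integral {0..t} \<phi>) < r" if "n \<ge> N" for n
    proof -
      define h where "h = t / Suc n"
      have "t < real (Suc n) * d"
        using N that \<open>0 < d\<close> by (smt (verit) mult_right_mono of_nat_le_iff le_Suc_eq)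
      then have h: "0 < h" "h < d" "Suc n * h = t"
        using t by (auto simp: h_def field_simps simp del: of_nat_Suc)
      \<comment> \<open>The induction adds one cell at a time and compares the integral over it with
        the value at its left end.\<close>
      have "\<bar>(\<Sum>i<j. h * \<phi> (i * h)) - integral {0..j * h} \<phi>\<bar> \<le> \<epsilon> * (j * h)" if "j \<le> Suc n" for j :: nat
        using that
      proof (induction j)
        case (Suc j)
        have le: "0 \<le> j * h" "j * h \<le> Suc j * h" "Suc j * h \<le> t"
          using h(1) Suc.prems mult_right_mono[of "real (Suc j)" "real (Suc n)" h] h(3)
          by (auto simp: algebra_simps)
        have sub: "continuous_on {a..b} \<phi>" if "0 \<le> a" "b \<le> t" for a b
          by (rule continuous_on_subset[OF cont]) (use that in auto)
        have "integral {0..Suc j * h} \<phi> = integral {0..j * h} \<phi> + integral {j * h..Suc j * h} \<phi>"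
          using le by (intro Henstock_Kurzweil_Integration.integral_combine[symmetric]
              integrable_continuous_real sub) auto
        moreover have "integral {j * h..Suc j * h} \<phi> - h * \<phi> (j * h) =
            integral {j * h..Suc j * h} (\<lambda>s. \<phi> s - \<phi> (j * h))"
          using le h(1) by (subst Henstock_Kurzweil_Integration.integral_diff)
            (auto intro!: integrable_continuous_real sub simp: algebra_simps)
        moreover have "norm (integral {j * h..Suc j * h} (\<lambda>s. \<phi> s - \<phi> (j * h))) \<le> \<epsilon> * (Suc j * h - j * h)"
        proof (rule integral_bound)
          fix s assume s: "s \<in> {j * h..Suc j * h}"
          then have "\<bar>s - j * h\<bar> < d"
            using h by (auto simp: algebra_simps)
          moreover have "s \<in> {0..t}" "j * h \<in> {0..t}"
            using s le unfolding atLeastAtMost_iff by linarith+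
          ultimately show "norm (\<phi> s - \<phi> (j * h)) \<le> \<epsilon>"
            using d[of s "j * h"] by simp
        qed (use le in \<open>auto intro!: continuous_intros sub\<close>)
        ultimately show ?case
          using Suc by (simp add: algebra_simps abs_le_iff)
      qed simp
      from this[of "Suc n"] show ?thesis
        using \<epsilon>(2) unfolding h(3) by (simp add: h_def)
    qed
    then show "\<exists>N. \<forall>n\<ge>N. norm ((\<Sum>i<Suc n. t / Suc n * \<phi> (i * (t / Suc n))) - integral {0..t} \<phi>) < r"
      by blast
  qed
  moreover have "(\<lambda>n. t / Suc n * \<phi> t) \<longlonglongrightarrow> 0"
    using tendsto_mult_left_zero[OF LIMSEQ_Suc[OF lim_const_over_n[of t]], of "\<phi> t"] by simp
  ultimately have "(\<lambda>n. (\<Sum>i<Suc n. t / Suc n * \<phi> (i * (t / Suc n))) + t / Suc n * \<phi> t) \<longlonglongrightarrow> integral {0..t} \<phi> + 0"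
    by (rule tendsto_add)
  moreover have "(\<Sum>i\<le>Suc n. t / Suc n * \<phi> (i * (t / Suc n))) =
      (\<Sum>i<Suc n. t / Suc n * \<phi> (i * (t / Suc n))) + t / Suc n * \<phi> t" for n
    by (simp add: lessThan_Suc_atMost del: of_nat_Suc)
  ultimately show ?thesis by simp
qed

section \<open>Mixing over the initial measure and dominated convergence\<close>

context reversible_circle_diffusion
begin

lemma measurable_P_\<mu>: "P \<in> \<mu> \<rightarrow>\<^sub>M subprob_algebra path_space"
  using measurable_prob_algebraD[OF kernel_measurable] measurable_cong_sets[OF sets_\<mu> refl] by blast

lemma sets_initial_law: "sets (initial_law P \<mu>) = sets path_space"
  unfolding initial_law_def
  by (rule sets_bind[where N = path_space])
    (simp_all add: sets_P sets_eq_imp_space_eq[OF sets_\<mu>])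

text \<open>A mixture of probability laws has the total mass of \<mu>. Finiteness makes constants
  integrable as dominating functions.\<close>

lemma finite_measure_initial_law: "finite_measure (initial_law P \<mu>)"
proof (rule finite_measureI)
  have "emeasure (initial_law P \<mu>) (space (initial_law P \<mu>)) = (\<integral>\<^sup>+x. emeasure (P x) (space path_space) \<partial>\<mu>)"
    unfolding sets_eq_imp_space_eq[OF sets_initial_law]
    by (rule emeasure_initial_law[OF diffusion sets_\<mu> sets.top])
  also have "\<dots> = (\<integral>\<^sup>+x. 1 \<partial>\<mu>)"
    using prob_space.emeasure_space_1[OF prob_space_P] by (simp add: space_P)
  also have "\<dots> < \<infinity>"
    using finite_measure.emeasure_finite[OF finite_\<mu>] by (simp add: less_top)
  finally show "emeasure (initial_law P \<mu>) (space (initial_law P \<mu>)) \<noteq> \<infinity>"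
    by simp
qed

lemma integral_initial_law:
  fixes F :: "(real \<Rightarrow> circle) \<Rightarrow> real"
  assumes "F \<in> borel_measurable path_space" "\<And>w. w \<in> space path_space \<Longrightarrow> \<bar>F w\<bar> \<le> C"
  shows "(\<integral>w. F w \<partial>initial_law P \<mu>) = (\<integral>x. \<integral>w. F w \<partial>P x \<partial>\<mu>)"
  unfolding initial_law_def
  by (rule integral_bind[OF assms measurable_P_\<mu> finite_\<mu>, where B' = 1])
    (simp_all add: prob_space.emeasure_space_1[OF prob_space_P])

text \<open>The exponential of the Riemann sum, written as a product to match
  \<open>integral_path_product\<close>. Using \<open>Suc n\<close> steps keeps the mesh well defined
  at \<open>n = 0\<close>.\<close>

definition path_weight :: "(circle \<Rightarrow> real) \<Rightarrow> real \<Rightarrow> nat \<Rightarrow> (real \<Rightarrow> circle) \<Rightarrow> real" where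
  "path_weight V t n w = (\<Prod>i\<le>Suc n. exp (t / Suc n * V (w (i * (t / Suc n)))))"

lemma continuous_on_weight:
  fixes V :: "circle \<Rightarrow> real"
  assumes "continuous_on UNIV V"
  shows "continuous_on UNIV (\<lambda>x. exp (h * V x))"
  by (intro continuous_intros assms)

lemma measurable_path_weight:
  assumes "continuous_on UNIV V" "0 < t"
  shows "path_weight V t n \<in> borel_measurable path_space"
  unfolding path_weight_def
  using assms
  by (intro borel_measurable_prod
      measurable_eval[OF bounded_borel_continuous_circle[OF continuous_on_weight]]) auto

lemma path_weight_bound:
  assumes V: "\<And>x. \<bar>V x\<bar> \<le> B" and t: "0 < t"
  shows "\<bar>path_weight V t n w\<bar> \<le> exp (2 * t * B)"
proof -
  have B: "0 \<le> B" using V[of undefined] by linarith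
  have "(\<Sum>i\<le>Suc n. t / Suc n * V (w (i * (t / Suc n)))) \<le> (\<Sum>i\<le>Suc n. t / Suc n * B)"
    using V t by (intro sum_mono mult_left_mono) (auto simp: abs_le_iff)
  \<comment> \<open>There are \<open>n + 2\<close> sampling points for \<open>n + 1\<close> cells;
    the surplus at most doubles the bound, uniformly in \<open>n\<close>, as domination
    requires.\<close>
  also have "\<dots> = (1 + 1 / Suc n) * (t * B)"
    by (simp add: field_simps)
  also have "\<dots> \<le> 2 * (t * B)"
    using B t by (intro mult_right_mono) auto
  finally show ?thesis
    unfolding path_weight_def by (simp add: exp_sum[symmetric] mult.assoc del: of_nat_Suc sum.atMost_Suc prod.atMost_Suc)
qed

lemma path_weight_tendsto:
  assumes V: "continuous_on UNIV V" and t: "0 < t" and w: "w \<in> space path_space"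
  shows "(\<lambda>n. path_weight V t n w) \<longlonglongrightarrow> exp (integral {0..t} (\<lambda>r. V (w r)))"
proof -
  have "continuous_on {0..t} (\<lambda>r. V (w r))"
    using continuous_on_subset[OF continuous_on_path[OF w], of "{0..t}"]
    by (intro continuous_on_compose2[OF V]) auto
  from tendsto_exp[OF riemann_sum_tendsto_integral[OF t this]] show ?thesis
    unfolding path_weight_def by (simp add: exp_sum del: of_nat_Suc sum.atMost_Suc prod.atMost_Suc)
qed

lemma integral_path_weight:
  assumes V: "continuous_on UNIV V" and t: "0 < t"
    and f: "continuous_on UNIV f" and g: "continuous_on UNIV g"
  defines "h n \<equiv> t / real (Suc n)"
  defines "W n \<equiv> \<lambda>x. exp (h n * V x)"
  shows "(\<integral>w. path_weight V t n w * f (w t) * g (w 0) \<partial>initial_law P \<mu>) =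
    (\<integral>x. W n x * (twisted_op (h n) (W n) ^^ Suc n) f x * g x \<partial>\<mu>)"
proof -
  have h: "0 < h n" "real (Suc n) * h n = t" using t by (simp_all add: h_def)
  have f': "f \<in> bounded_borel" and g': "g \<in> bounded_borel" and W': "W n \<in> bounded_borel"
    using f g continuous_on_weight[OF V] by (auto simp: W_def intro: bounded_borel_continuous_circle)
  obtain A where A: "\<And>x. \<bar>f x\<bar> \<le> A" using f' by (rule bounded_borelE) blast
  obtain C where C: "\<And>x. \<bar>g x\<bar> \<le> C" using g' by (rule bounded_borelE) blast
  obtain B where B: "\<And>x. \<bar>V x\<bar> \<le> B"
    using bounded_borel_continuous_circle[OF V] by (rule bounded_borelE) blast
  have AC: "0 \<le> A" "0 \<le> C" using A[of undefined] C[of undefined] by linarith+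
  have meas: "(\<lambda>w. path_weight V t n w * f (w t) * g (w 0)) \<in> borel_measurable path_space"
    using t by (intro borel_measurable_times measurable_path_weight V measurable_eval f' g') auto
  have "(\<integral>w. path_weight V t n w * f (w t) * g (w 0) \<partial>initial_law P \<mu>) =
      (\<integral>x. \<integral>w. path_weight V t n w * f (w t) * g (w 0) \<partial>P x \<partial>\<mu>)"
  proof (rule integral_initial_law[OF meas])
    show "\<bar>path_weight V t n w * f (w t) * g (w 0)\<bar> \<le> exp (2 * t * B) * A * C" for w
      unfolding abs_mult using AC
      by (intro mult_mono path_weight_bound[OF B t] A C) auto
  qed
  also have "\<dots> = (\<integral>x. W n x * (twisted_op (h n) (W n) ^^ Suc n) f x * g x \<partial>\<mu>)"
  proof (rule Bochner_Integration.integral_cong[OF refl])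
    fix x
    \<comment> \<open>Under \<open>P x\<close> the path starts at \<open>x\<close> almost surely, so
      \<open>g (w 0)\<close> becomes a constant and leaves the inner integral.\<close>
    have "(\<integral>w. path_weight V t n w * f (w t) * g (w 0) \<partial>P x) =
        (\<integral>w. path_weight V t n w * f (w t) * g x \<partial>P x)"
    proof (rule integral_cong_AE)
      show "(\<lambda>w. path_weight V t n w * f (w t) * g (w 0)) \<in> borel_measurable (P x)"
        using meas by (simp add: measurable_P)
      show "(\<lambda>w. path_weight V t n w * f (w t) * g x) \<in> borel_measurable (P x)"
        unfolding measurable_P
        using t by (intro borel_measurable_times borel_measurable_const measurable_path_weight V
            measurable_eval[OF f']) auto
      show "AE w in P x. path_weight V t n w * f (w t) * g (w 0) = path_weight V t n w * f (w t) * g x"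
        using starts_at[of x] by eventually_elim simp
    qed
    also have "\<dots> = (\<integral>w. path_weight V t n w * f (w t) \<partial>P x) * g x"
      by simp
    also have "(\<integral>w. path_weight V t n w * f (w t) \<partial>P x) = W n x * (twisted_op (h n) (W n) ^^ Suc n) f x"
      using integral_path_product[OF W' less_imp_le[OF h(1)] f', where n = "Suc n" and x = x]
      unfolding h(2) by (simp only: path_weight_def W_def h_def)
    finally show "(\<integral>w. path_weight V t n w * f (w t) * g (w 0) \<partial>P x) =
        W n x * (twisted_op (h n) (W n) ^^ Suc n) f x * g x" .
  qed
  finally show ?thesis .
qed

text \<open>Exchanging \<open>f\<close> and \<open>g\<close> in \<open>integral_path_weight\<close>
  gives the other side, and \<open>twisted_op_symmetric\<close> identifies the two integrals over
  \<mu>.\<close>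

lemma integral_path_weight_symmetric:
  assumes V: "continuous_on UNIV V" and t: "0 < t"
    and f: "continuous_on UNIV f" and g: "continuous_on UNIV g"
  shows "(\<integral>w. path_weight V t n w * f (w t) * g (w 0) \<partial>initial_law P \<mu>) =
    (\<integral>w. path_weight V t n w * f (w 0) * g (w t) \<partial>initial_law P \<mu>)"
proof -
  let ?h = "t / Suc n"
  have "(\<integral>w. path_weight V t n w * f (w t) * g (w 0) \<partial>initial_law P \<mu>) =
      (\<integral>w. path_weight V t n w * g (w t) * f (w 0) \<partial>initial_law P \<mu>)"
    unfolding integral_path_weight[OF V t f g] integral_path_weight[OF V t g f]
    using twisted_op_symmetric[OF continuous_on_weight[OF V, of ?h] f g, of ?h "Suc n"] t
    by (simp add: mult_ac del: funpow.simps)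
  then show ?thesis
    by (simp add: mult_ac)
qed

text \<open>Dominated convergence along the Riemann sums. The times \<open>a\<close> and
  \<open>b\<close> are left free so that one statement covers both orders of the endpoints.\<close>

lemma path_weight_integral_tendsto:
  assumes V: "continuous_on UNIV V" and t: "0 < t"
    and f: "continuous_on UNIV f" and g: "continuous_on UNIV g" and "0 \<le> a" "0 \<le> b"
  shows "(\<lambda>n. \<integral>w. path_weight V t n w * f (w a) * g (w b) \<partial>initial_law P \<mu>) \<longlonglongrightarrow>
    (\<integral>w. exp (integral {0..t} (\<lambda>r. V (w r))) * f (w a) * g (w b) \<partial>initial_law P \<mu>)"
proof -
  have f': "f \<in> bounded_borel" and g': "g \<in> bounded_borel"
    using f g by (auto intro: bounded_borel_continuous_circle)
  obtain A where A: "\<And>x. \<bar>f x\<bar> \<le> A" using f' by (rule bounded_borelE) blast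
  obtain C where C: "\<And>x. \<bar>g x\<bar> \<le> C" using g' by (rule bounded_borelE) blast
  obtain B where B: "\<And>x. \<bar>V x\<bar> \<le> B"
    using bounded_borel_continuous_circle[OF V] by (rule bounded_borelE) blast
  have AC: "0 \<le> A" "0 \<le> C" using A[of undefined] C[of undefined] by linarith+
  have borel: "borel_measurable (initial_law P \<mu>) = borel_measurable path_space"
    by (rule measurable_cong_sets[OF sets_initial_law refl])
  have space: "space (initial_law P \<mu>) = space path_space"
    by (rule sets_eq_imp_space_eq[OF sets_initial_law])
  have meas: "(\<lambda>w. path_weight V t n w * f (w a) * g (w b)) \<in> borel_measurable (initial_law P \<mu>)" for n
    unfolding borel
    using assms(5,6) by (intro borel_measurable_times measurable_path_weight V t measurable_eval f' g')
  have lim: "(\<lambda>n. path_weight V t n w * f (w a) * g (w b)) \<longlonglongrightarrow>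
      exp (integral {0..t} (\<lambda>r. V (w r))) * f (w a) * g (w b)"
    if "w \<in> space (initial_law P \<mu>)" for w
    using that unfolding space by (intro tendsto_intros path_weight_tendsto V t)
  show ?thesis
  proof (rule integral_dominated_convergence)
    show "(\<lambda>w. exp (integral {0..t} (\<lambda>r. V (w r))) * f (w a) * g (w b)) \<in> borel_measurable (initial_law P \<mu>)"
      \<comment> \<open>Measurability of the exponential functional is inherited from the weights,
        of which it is a pointwise limit.\<close>
      by (rule borel_measurable_LIMSEQ_real[OF lim meas])
    show "integrable (initial_law P \<mu>) (\<lambda>_. exp (2 * t * B) * A * C)"
      by (rule finite_measure.integrable_const[OF finite_measure_initial_law])
    show "AE w in initial_law P \<mu>. norm (path_weight V t n w * f (w a) * g (w b)) \<le> exp (2 * t * B) * A * C" for n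
      unfolding real_norm_def abs_mult using AC
      by (intro AE_I2 mult_mono path_weight_bound[OF B t] A C) auto
  qed (use lim meas in auto)
qed

lemma feynman_kac_symmetric:
  fixes V :: "circle \<Rightarrow> real"
  assumes V: "continuous_on UNIV V" and f: "continuous_on UNIV f" and g: "continuous_on UNIV g"
    and t: "0 \<le> t"
  shows "(\<integral>w. exp (integral {0..t} (\<lambda>r. V (w r))) * f (w t) * g (w 0) \<partial>initial_law P \<mu>)
   = (\<integral>w. exp (integral {0..t} (\<lambda>r. V (w r))) * f (w 0) * g (w t) \<partial>initial_law P \<mu>)"
\<comment> \<open>For \<open>t = 0\<close> the two integrands coincide. For positive
  \<open>t\<close> both sides are limits of the same sequence.\<close>
proof (cases "t = 0")
  case False
  then have t: "0 < t" using t by simp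
  show ?thesis
    using path_weight_integral_tendsto[OF V t f g, where a = t and b = 0] path_weight_integral_tendsto[OF V t f g, where a = 0 and b = t] t
    unfolding integral_path_weight_symmetric[OF V t f g] by (auto intro: LIMSEQ_unique)
qed simp

end

theorem lemma3p1:
  fixes V :: "circle \<Rightarrow> real"
    and \<mu> :: "circle measure"
    and P :: "circle \<Rightarrow> (real \<Rightarrow> circle) measure"
  assumes V_lipschitz: "\<exists>C. C-lipschitz_on UNIV V"
    and \<mu>_borel: "sets \<mu> = sets borel"
    and \<mu>_finite: "finite_measure \<mu>"
    and selfadjoint: "selfadjoint_in_L2 C2_circle half_laplacian \<mu>"
    and P_diffusion: "diffusion_with_generator C2_circle half_laplacian P"
  shows "\<forall>t\<ge>0. \<forall>f g :: circle \<Rightarrow> real. continuous_on UNIV f \<longrightarrow> continuous_on UNIV g \<longrightarrow>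
     (\<integral>w. exp (integral {0..t} (\<lambda>r. V (w r))) * f (w t) * g (w 0) \<partial>initial_law P \<mu>)
   = (\<integral>w. exp (integral {0..t} (\<lambda>r. V (w r))) * f (w 0) * g (w t) \<partial>initial_law P \<mu>)"
proof -
  interpret reversible_circle_diffusion P \<mu>
    by (intro reversible_circle_diffusion.intro circle_diffusion.intro
        reversible_circle_diffusion_axioms.intro P_diffusion \<mu>_borel \<mu>_finite selfadjoint)
  have "continuous_on UNIV V"
    using V_lipschitz lipschitz_on_continuous_on by blast
  then show ?thesis
    using feynman_kac_symmetric by blast
qed

end
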